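(* Let $a,b\in\mathbb{Z}\setminus\{0\}$ and $a_1,a_2,b_1,b_2,c\in\mathbb{Z}$. Then the affine cubic surface $$\bigl(xyz=ax^3+by^3+c+a_2x^2+a_1x+b_2y^2+b_1y\bigr)\subset\mathbb{A}^3$$ has infinitely many integral points, i.e. the equation $xyz=ax^3+by^3+c+a_2x^2+a_1x+b_2y^2+b_1y$ has infinitely many solutions $(x,y,z)\in\mathbb{Z}^3$. *)

theory Defs
  imports Main
begin

end

theory Submission
  imports Defs
begin

text \<open>
  If \<open>c = 0\<close>, all points \<open>(0, 0, z)\<close> are solutions. For \<open>c \<noteq> 0\<close> we follow Mordell. Write
  \<open>g(y) = b y\<^sup>3 + b\<^sub>2 y\<^sup>2 + b\<^sub>1 y + c\<close>. If a solution \<open>(x, y)\<close> is mutated to \<open>u = g(y) / x\<close> and then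
  to \<open>v = P\<^sub>0(u) / y\<close>, one obtains a coprime pair with \<open>v dvd P\<^sub>0(u)\<close> and \<open>u dvd P\<^sub>1(v)\<close> for two
  monic cubics \<open>P\<^sub>0\<close> and \<open>P\<^sub>1\<close>; conversely such a pair yields a solution. Mutating further gives
  monic cubics \<open>P\<^sub>n\<close> whose constant terms have only prime factors of \<open>abc\<close>, and from a coprime
  pair with \<open>s\<^sub>n\<^sub>+\<^sub>1 dvd P\<^sub>n(s\<^sub>n)\<close> and \<open>s\<^sub>n dvd P\<^sub>n\<^sub>+\<^sub>1(s\<^sub>n\<^sub>+\<^sub>1)\<close> one descends to level 0 by
  \<open>s\<^sub>n\<^sub>-\<^sub>1 = P\<^sub>n(s\<^sub>n) / s\<^sub>n\<^sub>+\<^sub>1\<close>. Once \<open>s\<^sub>n\<close> is large compared with the coefficients, the descent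
  strictly increases absolute values, so starting at arbitrarily high levels gives arbitrarily large
  solutions.

  Every pair of units is a possible start. If \<open>\<bar>abc\<bar> > 1\<close>, the constant term of \<open>P\<^sub>n\<close> grows so fast
  that \<open>P\<^sub>n(1)\<close> is large at once. If \<open>\<bar>abc\<bar> = 1\<close>, the cubics are periodic up to signs: a root \<open>\<plusminus>1\<close>
  of some \<open>P\<^sub>n\<close> allows an arbitrary neighbour; if some \<open>\<bar>P\<^sub>n(\<plusminus>1)\<bar> \<ge> 2\<close>, two steps from a pair of units
  reach a large value; in the remaining finitely many cases explicit starts exist.
\<close>

section \<open>Monic cubics: mutation and coprimality\<close>

definition cubic :: "int \<Rightarrow> int \<Rightarrow> int \<Rightarrow> int \<Rightarrow> int" where
  "cubic p q k t = t ^ 3 + p * t ^ 2 + q * t + k"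

lemma cubic_eq_mult_add: "cubic p q k t = t * (t ^ 2 + p * t + q) + k"
  by (simp add: cubic_def algebra_simps power2_eq_square power3_eq_cube)

text \<open>Modulo \<open>u\<close> one has \<open>w * v = K\<close> with \<open>K = k * r\<close>,
  so \<open>v ^ 3 * cubic p q k w\<close> is congruent to \<open>k\<close> times the cubic in
  \<open>v\<close>. As \<open>v\<close> is a unit modulo \<open>u\<close>, the factor
  \<open>v ^ 3\<close> cancels.\<close>

lemma cubic_mutation_dvd:
  fixes u v w :: int
  assumes w: "w * v = cubic p' q' (k * r) u"
    and u: "u dvd cubic (q * r) (p * (k * r) * r) ((k * r) ^ 2 * r) v"
    and "coprime u v"
  shows "u dvd cubic p q k w"
proof -
  define e where "e = u ^ 2 + p' * u + q'"
  define K where "K = k * r"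
  have wv: "w * v = u * e + K"
    using w by (simp add: cubic_eq_mult_add e_def K_def)
  have "v ^ 3 * cubic p q k w = (w * v) ^ 3 + p * v * (w * v) ^ 2 + q * v ^ 2 * (w * v) + k * v ^ 3"
    by (simp add: cubic_def) algebra
  also have "\<dots> = k * cubic (q * r) (p * K * r) (K ^ 2 * r) v
      + u * (e * ((u * e) ^ 2 + 3 * u * e * K + 3 * K ^ 2 + p * v * (u * e + 2 * K) + q * v ^ 2))"
    unfolding wv cubic_def K_def by algebra
  finally have "u dvd v ^ 3 * cubic p q k w"
    using u by (simp add: K_def)
  moreover have "coprime u (v ^ 3)"
    using \<open>coprime u v\<close> by simp
  ultimately show ?thesis
    by (simp add: coprime_dvd_mult_right_iff)
qed

text \<open>Modulo \<open>d\<close> only the leading term \<open>u ^ 3\<close> survives, and it is a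
  unit there; hence so is its factor \<open>w\<close>.\<close>

lemma coprime_if_mult_eq_cubic:
  fixes u v w d :: int
  assumes "w * v = cubic p q k u" "coprime u d" "d dvd p" "d dvd q" "d dvd k"
  shows "coprime w d"
proof -
  have "d dvd p * u ^ 2 + q * u + k"
    using assms by simp
  then obtain e where e: "p * u ^ 2 + q * u + k = d * e" ..
  have eq: "w * v = u ^ 3 + d * e"
    using assms(1) e by (simp add: cubic_def)
  have "coprime (u ^ 3) d"
    using \<open>coprime u d\<close> by simp
  show ?thesis
  proof (rule coprimeI)
    fix g assume "g dvd w" "g dvd d"
    then have "g dvd u ^ 3 + d * e" "g dvd d * e"
      using eq by (metis dvd_mult2, simp)
    then have "g dvd u ^ 3"
      by (simp add: dvd_add_left_iff)
    then show "is_unit g"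
      using \<open>g dvd d\<close> \<open>coprime (u ^ 3) d\<close> by (simp add: coprime_def)
  qed
qed

lemma coprime_if_dvd_cubic:
  fixes u w :: int
  assumes "w dvd cubic p q k u" "coprime u k"
  shows "coprime w u"
proof (rule coprimeI)
  fix g assume "g dvd w" "g dvd u"
  then have "g dvd u * (u ^ 2 + p * u + q) + k" "g dvd u * (u ^ 2 + p * u + q)"
    using assms(1) dvd_trans by (auto simp: cubic_eq_mult_add)
  then have "g dvd k"
    by (simp add: dvd_add_right_iff)
  then show "is_unit g"
    using \<open>g dvd u\<close> assms(2) by (simp add: coprime_def)
qed

section \<open>Lower bounds for values of cubics\<close>

definition growth_bound :: "int \<Rightarrow> int \<Rightarrow> int \<Rightarrow> int" where
  "growth_bound p q k = \<bar>p\<bar> + \<bar>q\<bar> + \<bar>k\<bar> + 2"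

text \<open>The summand 2 in \<open>growth_bound\<close> leaves \<open>2 * u ^ 2\<close> after the
  lower terms are paid for: one \<open>u ^ 2\<close> for the claim, one for strictness.\<close>

lemma abs_cubic_gt_square:
  assumes "growth_bound p q k \<le> \<bar>u\<bar>"
  shows "u ^ 2 < \<bar>cubic p q k u\<bar>"
proof -
  let ?x = "\<bar>u\<bar>"
  have x: "1 \<le> ?x"
    using assms by (simp add: growth_bound_def)
  have "(\<bar>p\<bar> + \<bar>q\<bar> + \<bar>k\<bar> + 2) * ?x ^ 2 \<le> ?x * ?x ^ 2"
    using assms by (intro mult_right_mono) (simp_all add: growth_bound_def)
  moreover have "\<bar>q\<bar> * ?x \<le> \<bar>q\<bar> * ?x ^ 2"
    using x by (intro mult_left_mono self_le_power) auto
  moreover have "\<bar>k\<bar> * 1 \<le> \<bar>k\<bar> * ?x ^ 2"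
    using x by (intro mult_left_mono one_le_power) auto
  moreover have "1 \<le> ?x ^ 2"
    using x by (rule one_le_power)
  ultimately have "?x ^ 2 + \<bar>p\<bar> * ?x ^ 2 + \<bar>q\<bar> * ?x + \<bar>k\<bar> < ?x ^ 3"
    by (simp add: algebra_simps power2_eq_square power3_eq_cube)
  then have "?x ^ 2 < \<bar>u ^ 3\<bar> - \<bar>p * u ^ 2\<bar> - \<bar>q * u\<bar> - \<bar>k\<bar>"
    by (simp add: abs_mult power_abs)
  also have "\<dots> \<le> \<bar>cubic p q k u\<bar>"
    unfolding cubic_def by linarith
  finally show ?thesis
    by simp
qed

text \<open>For the better of the two signs, the absolute values of the even part
  \<open>p * x ^ 2 + k\<close> and the odd part \<open>x ^ 3 + q * x\<close> add up. The condition
  on \<open>p\<close> and \<open>q\<close> excludes cancellation such as \<open>p = 0\<close>,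
  \<open>q = - x ^ 2\<close>, where one value is just \<open>k\<close>.\<close>

lemma cubic_large_at_signed_argument:
  assumes "\<bar>k\<bar> = 1" "2 \<le> \<bar>x\<bar>" "2 \<le> \<bar>p\<bar> \<or> q = 0 \<or> \<bar>p\<bar> = 1 \<and> \<bar>q\<bar> = 1"
  shows "\<exists>d. \<bar>d\<bar> = 1 \<and> \<bar>x\<bar> + 5 \<le> \<bar>cubic p q k (d * x)\<bar>"
proof -
  define A where "A = \<bar>p * x ^ 2 + k\<bar>"
  define B where "B = \<bar>x ^ 3 + q * x\<bar>"
  have sum: "A + B = max \<bar>cubic p q k (1 * x)\<bar> \<bar>cubic p q k (-1 * x)\<bar>"
    unfolding A_def B_def cubic_def by (simp add: max_def abs_if)
  have sq: "2 * \<bar>x\<bar> \<le> x ^ 2" "4 \<le> x ^ 2"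
    using mult_mono[OF assms(2) assms(2)] mult_right_mono[OF assms(2), of "\<bar>x\<bar>"]
    by (simp_all add: power2_eq_square)
  have A: "\<bar>p\<bar> * x ^ 2 - 1 \<le> A"
    unfolding A_def using assms(1) abs_mult[of p "x ^ 2"] by simp
  have B: "B = \<bar>x ^ 2 + q\<bar> * \<bar>x\<bar>"
    unfolding B_def by (simp add: algebra_simps power2_eq_square power3_eq_cube flip: abs_mult)
  have nonneg: "0 \<le> A" "0 \<le> B"
    by (simp_all add: A_def B_def)
  have "\<bar>x\<bar> + 5 \<le> A + B"
    using assms(3)
  proof (elim disjE conjE)
    assume "2 \<le> \<bar>p\<bar>"
    then have "2 * x ^ 2 \<le> \<bar>p\<bar> * x ^ 2"
      by (intro mult_right_mono) auto
    then show ?thesis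
      using A nonneg sq assms(2) by linarith
  next
    assume "q = 0"
    then have "4 * \<bar>x\<bar> \<le> B"
      unfolding B using sq by (intro mult_right_mono) auto
    then show ?thesis
      using nonneg assms(2) by linarith
  next
    assume pq: "\<bar>p\<bar> = 1" "\<bar>q\<bar> = 1"
    then have "3 * \<bar>x\<bar> \<le> B"
      unfolding B using sq by (intro mult_right_mono) auto
    then show ?thesis
      using A pq sq assms(2) by simp
  qed
  then have "\<bar>x\<bar> + 5 \<le> \<bar>cubic p q k (1 * x)\<bar> \<or> \<bar>x\<bar> + 5 \<le> \<bar>cubic p q k (-1 * x)\<bar>"
    unfolding sum by linarith
  then show ?thesis
    by (metis abs_1 abs_minus_cancel)
qed

section \<open>Explicit starts for the exceptional cubics\<close>

text \<open>These cubics take only the values \<open>\<plusminus>1\<close> at \<open>\<plusminus>1\<close>, so mutation never leaves the pairs of units and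
  other starting pairs have to be supplied; the ones below were found by a search.\<close>

lemma exceptional_cubics_start_normalized:
  assumes "(p, q) \<in> {(-2, -1), (-1, -2), (-1, 0), (0, -1)}"
    and "(p', q') \<in> {(-2, -1), (-1, -2), (-1, 0), (0, -1)}"
  shows "\<exists>u v. v dvd cubic p q 1 u \<and> u dvd cubic p' q' 1 v \<and> \<bar>v\<bar> \<le> \<bar>u\<bar> \<and> 7 \<le> \<bar>u\<bar>"
proof -
  define E where "E p q p' q' \<longleftrightarrow>
    (\<exists>u v. v dvd cubic p q 1 u \<and> u dvd cubic p' q' 1 v \<and> \<bar>v\<bar> \<le> \<bar>u\<bar> \<and> 7 \<le> \<bar>u\<bar>)" for p q p' q'
  have I: "E p q p' q'"
    if "v dvd cubic p q 1 u" "u dvd cubic p' q' 1 v" "\<bar>v\<bar> \<le> \<bar>u\<bar>" "7 \<le> \<bar>u\<bar>" for p q p' q' u v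
    unfolding E_def using that by blast
  have "E (-2) (-1) (-2) (-1)" "E (-2) (-1) (-1) (-2)" "E (-2) (-1) (-1) 0" "E (-2) (-1) 0 (-1)"
    by (rule I[of 293 _ _ "-601"], simp_all add: cubic_def,
        rule I[of "-41" _ _ 97], simp_all add: cubic_def,
        rule I[of "-7" _ _ 17], simp_all add: cubic_def,
        rule I[of "-13" _ _ 37], simp_all add: cubic_def)
  moreover
  have "E (-1) (-2) (-2) (-1)" "E (-1) (-2) (-1) (-2)" "E (-1) (-2) (-1) 0" "E (-1) (-2) 0 (-1)"
    by (rule I[of 461 _ _ "-727"], simp_all add: cubic_def,
        rule I[of "-43" _ _ "-449"], simp_all add: cubic_def,
        rule I[of "-7" _ _ "-23"], simp_all add: cubic_def,
        rule I[of 13 _ _ 19], simp_all add: cubic_def)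
  moreover
  have "E (-1) 0 (-2) (-1)" "E (-1) 0 (-1) (-2)" "E (-1) 0 (-1) 0" "E (-1) 0 0 (-1)"
    by (rule I[of "-5" _ _ "-13"], simp_all add: cubic_def,
        rule I[of 5 _ _ 7], simp_all add: cubic_def,
        rule I[of "-7" _ _ "-17"], simp_all add: cubic_def,
        rule I[of "-5" _ _ 7], simp_all add: cubic_def)
  moreover
  have "E 0 (-1) (-2) (-1)" "E 0 (-1) (-1) (-2)" "E 0 (-1) (-1) 0" "E 0 (-1) 0 (-1)"
    by (rule I[of "-5" _ _ 13], simp_all add: cubic_def,
        rule I[of 5 _ _ "-7"], simp_all add: cubic_def,
        rule I[of "-7" _ _ 23], simp_all add: cubic_def,
        rule I[of "-5" _ _ "-7"], simp_all add: cubic_def)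
  ultimately show ?thesis
    using assms unfolding E_def[symmetric] by auto
qed

text \<open>Rescaling the argument and the value by the sign \<open>k\<close> makes the constant
  term 1; the values at 1 and -1 then leave just the four pairs of coefficients treated
  above.\<close>

lemma exceptional_cubics_start:
  assumes "\<bar>k\<bar> = 1" "\<bar>cubic p q k 1\<bar> = 1" "\<bar>cubic p q k (-1)\<bar> = 1"
    and "\<bar>k'\<bar> = 1" "\<bar>cubic p' q' k' 1\<bar> = 1" "\<bar>cubic p' q' k' (-1)\<bar> = 1"
  shows "\<exists>u v. v dvd cubic p q k u \<and> u dvd cubic p' q' k' v \<and> \<bar>v\<bar> \<le> \<bar>u\<bar> \<and> 7 \<le> \<bar>u\<bar>"
proof -
  have norm: "(k * p, q) \<in> {(-2, -1), (-1, -2), (-1, 0), (0, -1)}"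
    if "\<bar>k\<bar> = 1" "\<bar>cubic p q k 1\<bar> = 1" "\<bar>cubic p q k (-1)\<bar> = 1" for p q k
  proof -
    have "k = 1 \<or> k = -1"
      using that(1) by linarith
    then show ?thesis
      using that(2,3) by (elim disjE) (simp_all add: cubic_def, presburger+)
  qed
  have sign: "cubic p q k (k * u) = k * cubic (k * p) q 1 u" if "\<bar>k\<bar> = 1" for p q k u
  proof -
    have "k = 1 \<or> k = -1"
      using that by linarith
    then show ?thesis
      by (elim disjE) (simp_all add: cubic_def algebra_simps)
  qed
  obtain u v where uv: "v dvd cubic (k * p) q 1 u" "u dvd cubic (k' * p') q' 1 v" "\<bar>v\<bar> \<le> \<bar>u\<bar>" "7 \<le> \<bar>u\<bar>"
    using exceptional_cubics_start_normalized[OF norm[OF assms(1-3)] norm[OF assms(4-6)]] by blast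
  show ?thesis
  proof (intro exI conjI)
    show "k' * v dvd cubic p q k (k * u)"
      using uv(1) assms(1,4) by (simp add: sign mult_unit_dvd_iff')
    show "k * u dvd cubic p' q' k' (k' * v)"
      using uv(2) assms(1,4) by (simp add: sign mult_unit_dvd_iff')
  qed (use uv(3,4) assms(1,4) in \<open>simp_all add: abs_mult\<close>)
qed

section \<open>The sequence of mutated cubics and the descent\<close>

locale mordell_equation =
  fixes a b c a\<^sub>1 a\<^sub>2 b\<^sub>1 b\<^sub>2 :: int
  assumes nonzero: "a \<noteq> 0" "b \<noteq> 0" "c \<noteq> 0"
begin

text \<open>\<open>R n = K (n + 1) / K n\<close>, and the recursions say that
  \<open>P (n + 2) t = t\<^sup>3 * P n (K (n + 1) / t) / K n\<close>.\<close>

fun K R :: "nat \<Rightarrow> int" where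
  "K 0 = a * c ^ 2"
| "K (Suc n) = K n * R n"
| "R 0 = b * a ^ 2 * c ^ 3"
| "R (Suc n) = K n * R n * R n"

fun quad lin :: "nat \<Rightarrow> int" where
  "quad 0 = a\<^sub>1"
| "quad (Suc 0) = b\<^sub>1 * a * c"
| "quad (Suc (Suc n)) = lin n * R n"
| "lin 0 = a\<^sub>2 * c"
| "lin (Suc 0) = b\<^sub>2 * a ^ 2 * c ^ 3"
| "lin (Suc (Suc n)) = quad n * K (Suc n) * R n"

text \<open>With \<open>f x = a * x ^ 3 + a\<^sub>2 * x ^ 2 + a\<^sub>1 * x + c\<close> and
  \<open>g\<close> its analogue in \<open>y\<close>, the initial values encode
  \<open>P 0 u = u ^ 3 * f (c / u) / c\<close> and
  \<open>P 1 v = v ^ 3 * g (K 0 / v) / c\<close>.\<close>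

definition P :: "nat \<Rightarrow> int \<Rightarrow> int" where
  "P n = cubic (quad n) (lin n) (K n)"

abbreviation T :: "nat \<Rightarrow> int" where
  "T n \<equiv> growth_bound (quad n) (lin n) (K n)"

text \<open>The guard \<open>n > 0\<close> reflects that \<open>quad 1\<close> and
  \<open>lin 1\<close> need not be multiples of \<open>b\<close>, so the last descent step may lose
  coprimality of the first entry to \<open>b\<close>.\<close>

definition admissible :: "nat \<Rightarrow> int \<Rightarrow> int \<Rightarrow> bool" where
  "admissible n u v \<longleftrightarrow> v dvd P n u \<and> u dvd P (Suc n) v \<and> coprime u v \<and>
     coprime v (a * c) \<and> coprime v b \<and> coprime u (a * c) \<and> (n > 0 \<longrightarrow> coprime u b)"

lemma R_dvd: "a * c dvd R n" "b dvd R n"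
  by (induction n) (auto simp: power2_eq_square power3_eq_cube)

lemma quad_lin_K_dvd:
  "a * c dvd quad (Suc n)" "a * c dvd lin (Suc n)" "a * c dvd K (Suc n)"
  "n > 0 \<Longrightarrow> b dvd quad (Suc n)" "n > 0 \<Longrightarrow> b dvd lin (Suc n)" "b dvd K (Suc n)"
  using R_dvd by (cases n; auto simp: power2_eq_square power3_eq_cube)+

lemma coprime_K_R:
  assumes "coprime u (a * c)" "coprime u b"
  shows "coprime u (K n) \<and> coprime u (R n)"
  using assms by (induction n) auto

lemma K_R_nonzero: "K n \<noteq> 0 \<and> R n \<noteq> 0"
  using nonzero by (induction n) auto

text \<open>\<open>P (n + 2)\<close> is exactly the cubic that \<open>cubic_mutation_dvd\<close>
  pairs with \<open>P n\<close>. Coprimality to \<open>a * c\<close>, and to \<open>b\<close> for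
  \<open>n > 0\<close>, persists because \<open>P (n + 1)\<close> is a pure cube modulo these
  numbers.\<close>

lemma admissible_step:
  assumes adm: "admissible (Suc n) u v" and w: "w * v = P (Suc n) u"
  shows "admissible n w u"
proof -
  have cop: "coprime u v" "coprime u (a * c)" "coprime u b"
    using adm by (auto simp: admissible_def)
  have "u dvd P n w"
    unfolding P_def
  proof (rule cubic_mutation_dvd)
    show "w * v = cubic (quad (Suc n)) (lin (Suc n)) (K n * R n) u"
      using w by (simp add: P_def)
    show "u dvd cubic (lin n * R n) (quad n * (K n * R n) * R n) ((K n * R n)\<^sup>2 * R n) v"
      using adm by (simp add: admissible_def P_def power2_eq_square algebra_simps)
  qed (rule cop)
  moreover have "w dvd P (Suc n) u"
    using w by (metis dvd_triv_left)
  moreover from this have "coprime w u"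
    unfolding P_def by (rule coprime_if_dvd_cubic) (use coprime_K_R cop in blast)
  moreover have "coprime w (a * c)"
    by (rule coprime_if_mult_eq_cubic[OF w[unfolded P_def]]) (use cop quad_lin_K_dvd in auto)
  moreover have "coprime w b" if "n > 0"
    by (rule coprime_if_mult_eq_cubic[OF w[unfolded P_def]]) (use cop quad_lin_K_dvd that in auto)
  ultimately show ?thesis
    using cop by (simp add: admissible_def)
qed

lemma quotient_grows:
  assumes "T n \<le> \<bar>u\<bar>" "\<bar>v\<bar> \<le> \<bar>u\<bar>" "w * v = P n u"
  shows "\<bar>u\<bar> < \<bar>w\<bar>"
proof (rule ccontr)
  assume "\<not> \<bar>u\<bar> < \<bar>w\<bar>"
  then have "\<bar>w\<bar> * \<bar>v\<bar> \<le> \<bar>u\<bar> * \<bar>u\<bar>"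
    using assms(2) by (intro mult_mono) auto
  then have "\<bar>P n u\<bar> \<le> u ^ 2"
    using assms(3) by (metis abs_mult abs_mult_self_eq power2_eq_square)
  then show False
    using abs_cubic_gt_square[OF assms(1)] by (simp add: P_def)
qed

lemma admissible_descent:
  assumes "admissible n u v" "\<bar>v\<bar> \<le> \<bar>u\<bar>" "\<forall>k\<le>n. T k \<le> \<bar>u\<bar>"
  shows "\<exists>u' v'. admissible 0 u' v' \<and> \<bar>v'\<bar> \<le> \<bar>u'\<bar> \<and> T 0 \<le> \<bar>u'\<bar> \<and> \<bar>u\<bar> + int n \<le> \<bar>u'\<bar>"
  using assms
proof (induction n arbitrary: u v)
  case 0
  then show ?case by auto
next
  case (Suc n)
  obtain w where w: "w * v = P (Suc n) u"
    using Suc.prems(1) unfolding admissible_def by (metis dvdE mult.commute)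
  have uw: "\<bar>u\<bar> < \<bar>w\<bar>"
    using quotient_grows[OF _ Suc.prems(2) w] Suc.prems(3) by blast
  have "\<exists>u' v'. admissible 0 u' v' \<and> \<bar>v'\<bar> \<le> \<bar>u'\<bar> \<and> T 0 \<le> \<bar>u'\<bar> \<and> \<bar>w\<bar> + int n \<le> \<bar>u'\<bar>"
  proof (rule Suc.IH)
    show "admissible n w u"
      using Suc.prems(1) w by (rule admissible_step)
    show "\<forall>k\<le>n. T k \<le> \<bar>w\<bar>"
      using Suc.prems(3) uw by (meson le_SucI less_imp_le order_trans)
  qed (use uw in simp)
  then show ?case
    using uw by force
qed

section \<open>From admissible pairs to integral points\<close>

definition solution :: "int \<Rightarrow> int \<Rightarrow> int \<Rightarrow> bool" where
  "solution x y z \<longleftrightarrow>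
     x * y * z = a * x ^ 3 + b * y ^ 3 + c + a\<^sub>2 * x ^ 2 + a\<^sub>1 * x + b\<^sub>2 * y ^ 2 + b\<^sub>1 * y"

lemma solution_of_admissible:
  assumes adm: "admissible 0 u v" and y: "y * v = P 0 u"
  shows "\<exists>x z. solution x y z"
proof -
  have cop: "coprime u v" "coprime u (a * c)"
    using adm by (auto simp: admissible_def)
  define e where "e = u ^ 2 + a\<^sub>1 * u + a\<^sub>2 * c"
  define g where "g = b * y ^ 3 + b\<^sub>2 * y ^ 2 + b\<^sub>1 * y + c"
  have yv: "y * v = u * e + a * c ^ 2"
    using y by (simp add: P_def cubic_eq_mult_add e_def)
  \<comment> \<open>Modulo \<open>u\<close>, \<open>y * v\<close> is \<open>a * c ^ 2\<close>, which
    turns \<open>v ^ 3 * g\<close> into \<open>c * P 1 v\<close>, a multiple of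
    \<open>u\<close>.\<close>
  have "v ^ 3 * g = b * (y * v) ^ 3 + b\<^sub>2 * v * (y * v) ^ 2 + b\<^sub>1 * v ^ 2 * (y * v) + c * v ^ 3"
    unfolding g_def by algebra
  also have "\<dots> = c * P (Suc 0) v + u * (e * (b * ((u * e) ^ 2 + 3 * u * e * (a * c ^ 2) + 3 * (a * c ^ 2) ^ 2)
      + b\<^sub>2 * v * (u * e + 2 * (a * c ^ 2)) + b\<^sub>1 * v ^ 2))"
    unfolding yv by (simp add: P_def cubic_def) algebra
  finally have "u dvd v ^ 3 * g"
    using adm by (simp add: admissible_def)
  then have "u dvd g"
    using cop by (simp add: coprime_dvd_mult_right_iff)
  then obtain x where x: "g = u * x" ..
  define h where "h = b * y ^ 2 + b\<^sub>2 * y + b\<^sub>1"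
  have ux: "u * x = y * h + c"
    unfolding x[symmetric] g_def h_def by algebra
  \<comment> \<open>Modulo \<open>y\<close>, \<open>u * x\<close> is \<open>c\<close>, so this
    product reduces to \<open>P 0 u = y * v\<close>, that is, to 0.\<close>
  have "u ^ 2 * (a * x ^ 2 + a\<^sub>2 * x + a\<^sub>1 + u) = a * (u * x) ^ 2 + a\<^sub>2 * u * (u * x) + a\<^sub>1 * u ^ 2 + u ^ 3"
    by algebra
  also have "\<dots> = y * v + y * (h * (a * (y * h + 2 * c) + a\<^sub>2 * u))"
    unfolding ux y by (simp add: P_def cubic_def) algebra
  finally have "y dvd u ^ 2 * (a * x ^ 2 + a\<^sub>2 * x + a\<^sub>1 + u)"
    by simp
  moreover have "y dvd P 0 u"
    using y by (metis dvd_triv_left)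
  then have "coprime y u"
    unfolding P_def by (rule coprime_if_dvd_cubic) (use cop in simp)
  ultimately have "y dvd a * x ^ 2 + a\<^sub>2 * x + a\<^sub>1 + u"
    by (simp add: coprime_dvd_mult_right_iff)
  then obtain z where z: "a * x ^ 2 + a\<^sub>2 * x + a\<^sub>1 + u = y * z" ..
  have "x * y * z = x * (a * x ^ 2 + a\<^sub>2 * x + a\<^sub>1) + g"
    using z x by algebra
  then have "solution x y z"
    unfolding solution_def g_def by algebra
  then show ?thesis by blast
qed

definition large_start :: "nat \<Rightarrow> bool" where
  "large_start n \<longleftrightarrow> (\<exists>u v. admissible n u v \<and> \<bar>v\<bar> \<le> \<bar>u\<bar> \<and> (\<forall>k\<le>n. T k \<le> \<bar>u\<bar>))"

lemma solution_of_large_start: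
  assumes "large_start n"
  shows "\<exists>x y z. solution x y z \<and> int n < \<bar>y\<bar>"
proof -
  obtain u' v' where "admissible n u' v'" "\<bar>v'\<bar> \<le> \<bar>u'\<bar>" "\<forall>k\<le>n. T k \<le> \<bar>u'\<bar>"
    using assms unfolding large_start_def by blast
  from admissible_descent[OF this] obtain u v where
    uv: "admissible 0 u v" "\<bar>v\<bar> \<le> \<bar>u\<bar>" "T 0 \<le> \<bar>u\<bar>" "\<bar>u'\<bar> + int n \<le> \<bar>u\<bar>"
    by blast
  obtain y where y: "y * v = P 0 u"
    using uv(1) unfolding admissible_def by (metis dvdE mult.commute)
  then have "\<bar>u\<bar> < \<bar>y\<bar>"
    using quotient_grows uv by blast
  then show ?thesis
    using solution_of_admissible[OF uv(1) y] uv(4) by fastforce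
qed

lemma infinite_solutions_if_large_starts:
  assumes "\<And>N. \<exists>n\<ge>N. large_start n"
  shows "infinite {(x, y, z). solution x y z}"
proof
  assume "finite {(x, y, z). solution x y z}"
  then have "finite ((\<lambda>(x, y, z). \<bar>y\<bar>) ` {(x, y, z). solution x y z})"
    by (rule finite_imageI)
  then obtain B where B: "\<And>x y z. solution x y z \<Longrightarrow> \<bar>y\<bar> \<le> B"
    by (force dest!: bdd_above_finite simp: bdd_above_def)
  obtain n where "nat B \<le> n" "large_start n"
    using assms by blast
  then show False
    using solution_of_large_start B by (smt (verit) nat_le_iff)
qed

lemma admissible_units:
  assumes "is_unit u" "is_unit v"
  shows "admissible n u v"
  using assms unfolding admissible_def by (meson is_unit_left_imp_coprime unit_imp_dvd)

section \<open>The case \<open>|a * b * c| > 1\<close>\<close>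

lemma quad_lin_bound:
  "\<exists>C\<ge>0. \<forall>n. \<bar>quad n\<bar> \<le> C * \<bar>K n\<bar> \<and> \<bar>lin n\<bar> \<le> C * \<bar>K n\<bar>"
proof -
  \<comment> \<open>Levels 0 and 1 determine \<open>C\<close>: passing from \<open>n\<close> to
    \<open>n + 2\<close> multiplies the constant term by at least as much as it multiplies either
    bound on the other coefficients.\<close>
  define C where "C = \<bar>quad 0\<bar> + \<bar>lin 0\<bar> + \<bar>quad 1\<bar> + \<bar>lin 1\<bar>"
  have K: "1 \<le> \<bar>K n\<bar>" "1 \<le> \<bar>R n\<bar>" for n
    using K_R_nonzero[of n] by linarith+
  have "C \<ge> 0"
    by (simp add: C_def)
  have base: "x \<le> C * \<bar>K n\<bar>" if "x \<le> C" for x n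
    using that mult_left_mono[OF K(1)[of n] \<open>C \<ge> 0\<close>] by simp
  have "\<bar>quad n\<bar> \<le> C * \<bar>K n\<bar> \<and> \<bar>lin n\<bar> \<le> C * \<bar>K n\<bar>" for n
  proof (induction n rule: induct_nat_012)
    case 0
    show ?case
      by (intro conjI base) (simp_all add: C_def)
  next
    case 1
    show ?case
      by (intro conjI base) (simp_all add: C_def)
  next
    case (ge2 n)
    have K': "\<bar>K (Suc (Suc n))\<bar> = \<bar>K n\<bar> * \<bar>R n\<bar> * (\<bar>K n\<bar> * \<bar>R n\<bar> * \<bar>R n\<bar>)"
      by (simp add: abs_mult)
    have "\<bar>quad (Suc (Suc n))\<bar> \<le> C * \<bar>K n\<bar> * \<bar>R n\<bar> * 1"
      using ge2.IH(1) by (simp add: abs_mult mult_right_mono)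
    also have "\<dots> \<le> C * \<bar>K n\<bar> * \<bar>R n\<bar> * (\<bar>K n\<bar> * \<bar>R n\<bar> * \<bar>R n\<bar>)"
      using K_R_nonzero[of n] \<open>C \<ge> 0\<close> 
      by (intro mult_left_mono) (simp_all flip: abs_mult add: int_one_le_iff_zero_less)
    finally have 1: "\<bar>quad (Suc (Suc n))\<bar> \<le> C * \<bar>K (Suc (Suc n))\<bar>"
      unfolding K' by (simp only: mult.assoc)
    have "\<bar>lin (Suc (Suc n))\<bar> \<le> C * \<bar>K n\<bar> * (\<bar>K n\<bar> * \<bar>R n\<bar> * \<bar>R n\<bar>) * 1"
      using mult_right_mono[OF conjunct1[OF ge2.IH(1)], of "\<bar>K n\<bar> * \<bar>R n\<bar> * \<bar>R n\<bar>"]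
      by (simp add: abs_mult mult.assoc)
    also have "\<dots> \<le> C * \<bar>K n\<bar> * (\<bar>K n\<bar> * \<bar>R n\<bar> * \<bar>R n\<bar>) * \<bar>R n\<bar>"
      using K(2)[of n] \<open>C \<ge> 0\<close> by (intro mult_left_mono) simp_all
    finally have "\<bar>lin (Suc (Suc n))\<bar> \<le> C * \<bar>K (Suc (Suc n))\<bar>"
      unfolding K' by (simp only: ac_simps)
    with 1 show ?case by blast
  qed
  then show ?thesis
    using \<open>C \<ge> 0\<close> by blast
qed

lemma abs_K_mono: "m \<le> n \<Longrightarrow> \<bar>K m\<bar> \<le> \<bar>K n\<bar>"
proof (induction rule: dec_induct)
  case (step n)
  have "\<bar>K n\<bar> * 1 \<le> \<bar>K n\<bar> * \<bar>R n\<bar>"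
    using K_R_nonzero[of n] by (intro mult_left_mono) auto
  with step show ?case
    by (simp add: abs_mult)
qed simp

text \<open>Every \<open>R n\<close> is a nonzero multiple of \<open>a * b * c\<close>, so
  \<open>|R n| >= 2\<close>, and the quadratic recursion at least doubles it.\<close>

lemma R_unbounded:
  assumes "\<bar>a * b * c\<bar> \<noteq> 1"
  shows "int n \<le> \<bar>R n\<bar>"
proof (induction n)
  case (Suc n)
  have "a * b * c dvd R n"
    by (induction n) (auto simp: power2_eq_square power3_eq_cube)
  then have "\<bar>a * b * c\<bar> \<le> \<bar>R n\<bar>"
    using K_R_nonzero[of n] by (simp add: dvd_imp_le_int)
  moreover have "\<bar>a * b * c\<bar> \<noteq> 0"
    using nonzero by simp
  ultimately have r: "2 \<le> \<bar>R n\<bar>"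
    using assms by linarith
  have "1 * (2 * \<bar>R n\<bar>) \<le> \<bar>K n\<bar> * (\<bar>R n\<bar> * \<bar>R n\<bar>)"
    using r K_R_nonzero[of n] by (intro mult_mono) auto
  then have "2 * \<bar>R n\<bar> \<le> \<bar>R (Suc n)\<bar>"
    by (simp add: abs_mult mult.assoc)
  with Suc r show ?case
    by simp
qed simp

lemma large_start_if_nonunit:
  assumes "\<bar>a * b * c\<bar> \<noteq> 1"
  shows "\<exists>n\<ge>N. large_start n"
proof -
  obtain C where C: "C \<ge> 0" "\<And>n. \<bar>quad n\<bar> \<le> C * \<bar>K n\<bar>" "\<And>n. \<bar>lin n\<bar> \<le> C * \<bar>K n\<bar>"
    using quad_lin_bound by blast
  \<comment> \<open>This forces \<open>|R n| >= 4 * C + 4\<close>, so the constant term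
    \<open>X ^ 2 * |R n|\<close> of \<open>P (n + 2)\<close> covers the coefficients
    \<open>C * X\<close> and \<open>C * X ^ 2\<close>, the leading 1 and the threshold
    \<open>(2 * C + 3) * X\<close>: the weights add up to \<open>4 * C + 4\<close>.\<close>
  define n where "n = N + nat (4 * C + 4)"
  define X where "X = \<bar>K (Suc n)\<bar>"
  have X: "1 \<le> X"
    using K_R_nonzero[of "Suc n"] unfolding X_def by linarith
  have T: "T k \<le> (2 * C + 3) * X" if "k \<le> Suc n" for k
  proof -
    have "1 \<le> \<bar>K k\<bar>"
      using K_R_nonzero[of k] by linarith
    then have "T k \<le> (2 * C + 3) * \<bar>K k\<bar>"
      using C(2,3)[of k] by (simp add: growth_bound_def algebra_simps)
    also have "\<dots> \<le> (2 * C + 3) * X"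
      using abs_K_mono[OF that] C(1) unfolding X_def by (intro mult_left_mono) auto
    finally show ?thesis .
  qed
  define u where "u = P (Suc (Suc n)) 1"
  have adm: "admissible (Suc n) u 1"
    by (rule admissible_step[OF admissible_units[of 1 1]]) (simp_all add: u_def)
  have XX: "X \<le> X ^ 2"
    using X by (intro self_le_power) auto
  have "int n \<le> \<bar>R n\<bar>"
    by (rule R_unbounded) fact
  then have "X ^ 2 * (4 * C + 4) \<le> X ^ 2 * \<bar>R n\<bar>"
    using C(1) by (intro mult_left_mono) (auto simp: n_def)
  also have "X ^ 2 * \<bar>R n\<bar> = \<bar>K (Suc (Suc n))\<bar>"
    by (simp add: X_def abs_mult power2_eq_square)
  finally have K: "X ^ 2 * (4 * C + 4) \<le> \<bar>K (Suc (Suc n))\<bar>" .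
  have "\<bar>lin n\<bar> * \<bar>R n\<bar> \<le> C * \<bar>K n\<bar> * \<bar>R n\<bar>"
    using C(3) by (intro mult_right_mono) auto
  then have q: "\<bar>quad (Suc (Suc n))\<bar> \<le> C * X"
    by (simp add: X_def abs_mult mult.assoc)
  have "\<bar>quad n\<bar> * (X * \<bar>R n\<bar>) \<le> C * \<bar>K n\<bar> * (X * \<bar>R n\<bar>)"
    using C(2) X by (intro mult_right_mono) auto
  also have "\<dots> = C * X * (\<bar>K n\<bar> * \<bar>R n\<bar>)"
    by (simp only: ac_simps)
  also have "\<dots> = C * X ^ 2"
    by (simp add: X_def abs_mult power2_eq_square)
  finally have l: "\<bar>lin (Suc (Suc n))\<bar> \<le> C * X ^ 2"
    by (simp only: lin.simps X_def abs_mult mult.assoc)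
  have "\<bar>K (Suc (Suc n))\<bar> - \<bar>quad (Suc (Suc n))\<bar> - \<bar>lin (Suc (Suc n))\<bar> - 1 \<le> \<bar>u\<bar>"
    unfolding u_def P_def cubic_def by simp
  then have "X ^ 2 * (4 * C + 4) - C * X - C * X ^ 2 - 1 \<le> \<bar>u\<bar>"
    using K q l by linarith
  moreover have "C * X \<le> C * X ^ 2"
    using XX C(1) by (rule mult_left_mono)
  ultimately have u: "(2 * C + 3) * X \<le> \<bar>u\<bar>"
    using X XX by (simp add: algebra_simps)
  have "0 \<le> C * X"
    using X C(1) by simp
  then have "\<bar>1\<bar> \<le> \<bar>u\<bar>"
    using u X by (simp add: algebra_simps)
  moreover have "\<forall>k\<le>Suc n. T k \<le> \<bar>u\<bar>"
    using T u order_trans by blast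
  ultimately have "large_start (Suc n)"
    using adm unfolding large_start_def by blast
  then show ?thesis
    by (intro exI[of _ "Suc n"]) (simp add: n_def)
qed

end

section \<open>The case \<open>|a * b * c| = 1\<close>\<close>

locale unit_mordell_equation = mordell_equation +
  assumes unit: "\<bar>a * b * c\<bar> = 1"
begin

lemma abs_unit: "\<bar>a\<bar> = 1" "\<bar>b\<bar> = 1" "\<bar>c\<bar> = 1"
proof -
  have "a * b * c dvd 1"
    using unit by simp
  then have "a dvd 1" "b dvd 1" "c dvd 1"
    by (metis dvd_mult_left dvd_mult_right)+
  then show "\<bar>a\<bar> = 1" "\<bar>b\<bar> = 1" "\<bar>c\<bar> = 1"
    by simp_all
qed

lemma abs_K_R: "\<bar>K n\<bar> = 1 \<and> \<bar>R n\<bar> = 1"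
  by (induction n) (simp_all add: abs_mult power_abs abs_unit)

lemma admissible_if_dvd:
  assumes "v dvd P n u" "u dvd P (Suc n) v"
  shows "admissible n u v"
proof -
  have "coprime v u"
    using assms(1) unfolding P_def
    by (rule coprime_if_dvd_cubic) (use abs_K_R[of n] in \<open>simp add: is_unit_right_imp_coprime\<close>)
  then have "coprime u v"
    by (simp add: coprime_commute)
  moreover have "coprime w a" "coprime w b" "coprime w c" for w
    using abs_unit by (simp_all add: is_unit_right_imp_coprime)
  ultimately show ?thesis
    using assms by (simp add: admissible_def)
qed

definition height :: "nat \<Rightarrow> int" where
  "height n = max \<bar>P n 1\<bar> \<bar>P n (-1)\<bar>"

text \<open>\<open>|quad n| + |lin n|\<close> is attained by the sum or the difference of the two,
  which is within 2 of a value of \<open>P n\<close> at a unit; \<open>|K n| + 2\<close> contributes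
  the other 3.\<close>

lemma T_le_height: "T n \<le> height n + 5"
proof -
  have "\<bar>quad n\<bar> + \<bar>lin n\<bar> \<le> \<bar>quad n + lin n\<bar> \<or> \<bar>quad n\<bar> + \<bar>lin n\<bar> \<le> \<bar>quad n - lin n\<bar>"
    by linarith
  moreover have "\<bar>quad n + lin n\<bar> \<le> \<bar>P n 1\<bar> + 2" "\<bar>quad n - lin n\<bar> \<le> \<bar>P n (-1)\<bar> + 2"
    using abs_K_R[of n] by (simp_all add: P_def cubic_def, linarith+)
  ultimately show ?thesis
    using abs_K_R[of n] unfolding growth_bound_def height_def max_def by (elim disjE) (simp_all split: if_split)
qed

text \<open>At a unit argument, the recursion for \<open>P (n + 2)\<close> evaluates
  \<open>P n\<close> at a unit, up to sign.\<close>

lemma height_Suc_Suc: "height (Suc (Suc n)) = height n"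
proof -
  have KR: "K n = 1 \<or> K n = -1" "R n = 1 \<or> R n = -1"
    using abs_K_R[of n] by linarith+
  then have "K n * P (Suc (Suc n)) e = e * P n (K (Suc n) * e)" if "e = 1 \<or> e = -1" for e
    using that by (elim disjE) (simp_all add: P_def cubic_def)
  then have "\<bar>P (Suc (Suc n)) e\<bar> = \<bar>P n (K (Suc n) * e)\<bar>" if "e = 1 \<or> e = -1" for e
    using that abs_K_R[of n] by (metis abs_1 abs_minus_cancel abs_mult mult_1)
  then have "height (Suc (Suc n)) = max \<bar>P n (K (Suc n))\<bar> \<bar>P n (- K (Suc n))\<bar>"
    unfolding height_def by simp
  also have "\<dots> = height n"
    using KR unfolding height_def by (elim disjE) (simp_all add: max.commute)
  finally show ?thesis .
qed

lemma abs_quad_lin_Suc_Suc: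
  "\<bar>quad (Suc (Suc n))\<bar> = \<bar>lin n\<bar>" "\<bar>lin (Suc (Suc n))\<bar> = \<bar>quad n\<bar>"
  using abs_K_R[of n] by (simp_all add: abs_mult)

lemma height_le: "height k \<le> max (height n) (height (Suc n))"
proof -
  have par: "height (2 * i) = height 0 \<and> height (Suc (2 * i)) = height 1" for i
    by (induction i) (simp_all add: height_Suc_Suc)
  have par': "height k = (if even k then height 0 else height 1)" for k
    using par by (cases "even k") (auto elim!: evenE oddE)
  show ?thesis
    unfolding par'[of k] par'[of n] par'[of "Suc n"] by simp
qed

lemma large_start_if_root:
  assumes "\<bar>e\<bar> = 1" "P (Suc n) e = 0"
  shows "large_start n"
proof -
  define u where "u = height n + height (Suc n) + 5"
  have nonneg: "0 \<le> height n" "0 \<le> height (Suc n)"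
    by (simp_all add: height_def)
  have "T k \<le> \<bar>u\<bar>" for k
    using T_le_height[of k] height_le[of k n] nonneg unfolding u_def by linarith
  moreover have "admissible n u e"
    using assms by (intro admissible_if_dvd) (simp_all add: unit_imp_dvd)
  moreover have "\<bar>e\<bar> \<le> \<bar>u\<bar>"
    using assms nonneg by (simp add: u_def)
  ultimately show ?thesis
    unfolding large_start_def by blast
qed

lemma large_start_if_height_ge_2:
  assumes ge2: "2 \<le> height (Suc (Suc n))" and max: "\<And>k. height k \<le> height (Suc (Suc n))"
    and "2 \<le> \<bar>quad (Suc n)\<bar> \<or> lin (Suc n) = 0 \<or> \<bar>quad (Suc n)\<bar> = 1 \<and> \<bar>lin (Suc n)\<bar> = 1"
  shows "large_start n"
proof -
  obtain e where e: "\<bar>e\<bar> = 1" "height (Suc (Suc n)) = \<bar>P (Suc (Suc n)) e\<bar>"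
    unfolding height_def max_def by (metis abs_1 abs_minus_cancel)
  define x where "x = P (Suc (Suc n)) e"
  \<comment> \<open>The start \<open>(e, d)\<close> at level \<open>n + 2\<close> mutates to
    \<open>(d * x, e)\<close>, so the choice of the unit \<open>d\<close> sets the sign of the next
    argument. The margin 5 is the one in \<open>T_le_height\<close>.\<close>
  obtain d where d: "\<bar>d\<bar> = 1" "\<bar>x\<bar> + 5 \<le> \<bar>P (Suc n) (d * x)\<bar>"
    unfolding P_def
    using cubic_large_at_signed_argument[OF _ _ assms(3), of "K (Suc n)" x] abs_K_R[of "Suc n"] ge2 e
    by (auto simp: x_def)
  define u where "u = e * P (Suc n) (d * x)"
  have sq: "d * d = 1" "e * e = 1"
    using d(1) e(1) by (metis abs_mult_self_eq mult_1)+
  have "admissible (Suc (Suc n)) e d"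
    using d(1) e(1) by (intro admissible_units) simp_all
  then have "admissible (Suc n) (d * x) e"
    by (rule admissible_step) (use sq in \<open>simp add: x_def ac_simps flip: mult.assoc\<close>)
  then have "admissible n u (d * x)"
    by (rule admissible_step) (use sq in \<open>simp add: u_def ac_simps flip: mult.assoc\<close>)
  moreover have "\<bar>u\<bar> \<ge> \<bar>x\<bar> + 5" "\<bar>d * x\<bar> = \<bar>x\<bar>"
    using d e(1) by (simp_all add: u_def abs_mult)
  moreover have "T k \<le> \<bar>u\<bar>" for k
    using T_le_height[of k] max[of k] e(2) \<open>\<bar>u\<bar> \<ge> \<bar>x\<bar> + 5\<close> unfolding x_def by linarith
  ultimately show ?thesis
    unfolding large_start_def by (intro exI[of _ u] exI[of _ "d * x"]) auto
qed

text \<open>If the coefficient condition fails, it holds two levels higher, where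
  \<open>|quad|\<close> and \<open>|lin|\<close> have changed places while the heights are
  unchanged.\<close>

lemma large_start_if_max_height:
  assumes "2 \<le> height (Suc (Suc n))" "\<And>k. height k \<le> height (Suc (Suc n))"
  shows "large_start n \<or> large_start (Suc (Suc n))"
proof (cases "2 \<le> \<bar>quad (Suc n)\<bar> \<or> lin (Suc n) = 0 \<or> \<bar>quad (Suc n)\<bar> = 1 \<and> \<bar>lin (Suc n)\<bar> = 1")
  case True
  then show ?thesis
    using large_start_if_height_ge_2 assms by blast
next
  case False
  then have "2 \<le> \<bar>lin (Suc n)\<bar> \<or> quad (Suc n) = 0"
    by linarith
  then have "2 \<le> \<bar>quad (Suc (Suc (Suc n)))\<bar> \<or> lin (Suc (Suc (Suc n))) = 0"
    using abs_quad_lin_Suc_Suc[of "Suc n"] by (metis abs_eq_0_iff)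
  then have "large_start (Suc (Suc n))"
    using large_start_if_height_ge_2[of "Suc (Suc n)"] assms
    unfolding height_Suc_Suc[of "Suc (Suc n)"] by blast
  then show ?thesis ..
qed

lemma large_start_if_unit: "\<exists>n\<ge>N. large_start n"
proof -
  consider (root) e n where "\<bar>e\<bar> = 1" "n \<ge> N" "P (Suc n) e = 0"
    | (ge2) "\<not> max (height N) (height (Suc N)) \<le> 1"
    | (exceptional) "\<And>n e. n \<ge> N \<Longrightarrow> \<bar>e\<bar> = 1 \<Longrightarrow> P (Suc n) e \<noteq> 0" "max (height N) (height (Suc N)) \<le> 1"
    by blast
  then show ?thesis
  proof cases
    case root
    then show ?thesis
      using large_start_if_root by blast
  next
    case ge2
    show ?thesis
    \<comment> \<open>Heights depend only on the parity of the level; the start is placed at the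
      parity of the larger one.\<close>
    proof (cases "height (Suc N) \<le> height N")
      case True
      then have "height k \<le> height (Suc (Suc N))" for k
        using height_le[of k N] by (simp add: height_Suc_Suc)
      then have "large_start N \<or> large_start (Suc (Suc N))"
        using large_start_if_max_height[of N] ge2 True by (simp add: height_Suc_Suc)
      then show ?thesis
        by (meson le_SucI order_refl)
    next
      case False
      then have "height k \<le> height (Suc (Suc (Suc N)))" for k
        using height_le[of k N] by (simp add: height_Suc_Suc)
      then have "large_start (Suc N) \<or> large_start (Suc (Suc (Suc N)))"
        using large_start_if_max_height[of "Suc N"] ge2 False by (simp add: height_Suc_Suc)
      then show ?thesis
        by (meson le_SucI order_refl)
    qed
  next
    case exceptional
    have height: "height k \<le> 1" for k
      using height_le[of k N] exceptional(2) by linarith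
    have unit: "\<bar>P (Suc n) e\<bar> = 1" if "n \<ge> N" "e = 1 \<or> e = -1" for n e
      using height[of "Suc n"] exceptional(1)[of n e] that unfolding height_def by auto
    obtain u v where uv: "v dvd P (Suc N) u" "u dvd P (Suc (Suc N)) v" "\<bar>v\<bar> \<le> \<bar>u\<bar>" "7 \<le> \<bar>u\<bar>"
      using exceptional_cubics_start unit[of N] unit[of "Suc N"] abs_K_R unfolding P_def
      by (metis le_SucI order_refl)
    \<comment> \<open>All heights are at most 1, so all thresholds are at most 6, below the
      guaranteed 7.\<close>
    have "T k \<le> \<bar>u\<bar>" for k
      using T_le_height[of k] height[of k] uv(4) by linarith
    then have "large_start (Suc N)"
      using admissible_if_dvd[OF uv(1,2)] uv(3) unfolding large_start_def by blast
    then show ?thesis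
      by (meson le_SucI order_refl)
  qed
qed

end

section \<open>Combining the cases\<close>

theorem (in mordell_equation) infinite_solutions: "infinite {(x, y, z). solution x y z}"
proof (rule infinite_solutions_if_large_starts)
  fix N
  show "\<exists>n\<ge>N. large_start n"
  proof (cases "\<bar>a * b * c\<bar> = 1")
    case True
    then interpret unit_mordell_equation
      by unfold_locales
    show ?thesis
      by (rule large_start_if_unit)
  qed (rule large_start_if_nonunit)
qed

theorem theorem3:
  fixes a b a\<^sub>1 a\<^sub>2 b\<^sub>1 b\<^sub>2 c :: int
  assumes "a \<noteq> 0" and "b \<noteq> 0"
  shows "infinite {(x :: int, y :: int, z :: int).
           x * y * z = a * x ^ 3 + b * y ^ 3 + c + a\<^sub>2 * x ^ 2 + a\<^sub>1 * x + b\<^sub>2 * y ^ 2 + b\<^sub>1 * y}"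
proof (cases "c = 0")
  case True
  have "infinite (range (\<lambda>z :: int. (0 :: int, 0 :: int, z)))"
    by (subst finite_image_iff) (simp_all add: inj_def infinite_UNIV_int)
  then show ?thesis
    by (rule infinite_super[rotated]) (use True in auto)
next
  case False
  then interpret mordell_equation a b c a\<^sub>1 a\<^sub>2 b\<^sub>1 b\<^sub>2
    using assms by unfold_locales
  show ?thesis
    using infinite_solutions unfolding solution_def .
qed

end
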